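(* Let $\mathcal{P} \subseteq \mathbb{R}^n$ and $\mathcal{Q} \subseteq \mathbb{R}^m$ be full-dimensional integrally closed lattice simplices, with $0$ in the interior of $\mathcal{P}$ and $\mathcal{P}$ reflexive. Let $v_0,\ldots,v_m$ be the vertices of $\mathcal{Q}$. Then for each $i \in \{0,\ldots,m\}$ the simplex $$\mathcal{P} *_i \mathcal{Q} := \operatorname{conv}\big((\mathcal{P} \times \{0\}^m) \cup (\{0\}^n \times (\mathcal{Q} - v_i))\big) \subseteq \mathbb{R}^{n+m}$$ is integrally closed.
   Context: A lattice polytope $\mathcal{P} \subseteq \mathbb{R}^N$ is integrally closed if for every positive integer $k$ and every $x \in k\mathcal{P} \cap \mathbb{Z}^N$ there exist $x_1, \ldots, x_k \in \mathcal{P} \cap \mathbb{Z}^N$ with $x = x_1 + \cdots + x_k$. A lattice polytope $\mathcal{P}$ is reflexive if $0$ lies in its interior and its polar dual $\mathcal{P}^{\Delta} := \{y : x \cdot y \le 1 \text{ for all } x \in \mathcal{P}\}$ is also a lattice polytope; a lattice translate of a reflexive polytope is also called reflexive. *)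

theory Defs
  imports "HOL-Analysis.Analysis"
begin

text \<open>Working over an arbitrary Euclidean space lets the same notions apply to
  \<open>real ^ 'n\<close> and to \<open>(real ^ 'n) \<times> (real ^ 'm)\<close>, which serves as (n+m)-dimensional space.\<close>

definition integer_lattice :: "'a::euclidean_space set" where
  "integer_lattice = {x. \<forall>b\<in>Basis. x \<bullet> b \<in> \<int>}"

lemma integer_lattice_vec:
  "(x :: real ^ 'n) \<in> integer_lattice \<longleftrightarrow> (\<forall>i. x $ i \<in> \<int>)"
  by (auto simp: integer_lattice_def Basis_vec_def inner_axis)

lemma integer_lattice_prod:
  "(x, y) \<in> integer_lattice \<longleftrightarrow> x \<in> integer_lattice \<and> y \<in> integer_lattice"
  by (simp add: integer_lattice_def Basis_prod_def ball_Un)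

definition lattice_polytope :: "'a::euclidean_space set \<Rightarrow> bool" where
  "lattice_polytope P \<longleftrightarrow> polytope P \<and> {v. v extreme_point_of P} \<subseteq> integer_lattice"

definition integrally_closed :: "'a::euclidean_space set \<Rightarrow> bool" where
  "integrally_closed P \<longleftrightarrow> lattice_polytope P \<and>
     (\<forall>k::nat. k \<ge> 1 \<longrightarrow>
        (\<forall>x \<in> (\<lambda>p. real k *\<^sub>R p) ` P \<inter> integer_lattice.
           \<exists>y. (\<forall>j\<in>{1..k}. y j \<in> P \<inter> integer_lattice) \<and> x = (\<Sum>j=1..k. y j)))"

definition polar_dual :: "'a::euclidean_space set \<Rightarrow> 'a set" where
  "polar_dual P = {y. \<forall>x\<in>P. x \<bullet> y \<le> 1}"

definition reflexive_at_origin :: "'a::euclidean_space set \<Rightarrow> bool" where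
  "reflexive_at_origin P \<longleftrightarrow>
     lattice_polytope P \<and> 0 \<in> interior P \<and> lattice_polytope (polar_dual P)"

definition reflexive_polytope :: "'a::euclidean_space set \<Rightarrow> bool" where
  "reflexive_polytope P \<longleftrightarrow>
     (\<exists>t R. t \<in> integer_lattice \<and> reflexive_at_origin R \<and> P = (\<lambda>x. x + t) ` R)"

definition free_sum_at ::
  "'a::euclidean_space set \<Rightarrow> 'b::euclidean_space set \<Rightarrow> 'b \<Rightarrow> ('a \<times> 'b) set" where
  "free_sum_at P Q v = convex hull ((P \<times> {0}) \<union> ({0} \<times> ((\<lambda>q. q - v) ` Q)))"

end

theory Submission
  imports Defs
begin

text \<open>Reflexivity makes the gauge of \<open>P\<close> integer-valued on lattice points: it is a maximum of
  inner products with the vertices of the polar dual.  So if \<open>(a, b)\<close> is a lattice point of the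
  \<open>k\<close>-th dilate of the free sum, with \<open>a \<in> s P\<close> for the gauge \<open>s\<close> of \<open>a\<close>, then \<open>s\<close> is a natural
  number, \<open>b\<close> lies in the \<open>(k - s)\<close>-th dilate of \<open>Q - v\<close>, and the two summands can be
  decomposed separately.\<close>

section \<open>Integer lattice, lattice polytopes and decompositions of lattice points\<close>

lemma integer_lattice_zero: "0 \<in> integer_lattice"
  by (simp add: integer_lattice_def)

lemma integer_lattice_add:
  "x \<in> integer_lattice \<Longrightarrow> y \<in> integer_lattice \<Longrightarrow> x + y \<in> integer_lattice"
  by (auto simp: integer_lattice_def inner_add_left)

lemma integer_lattice_diff:
  "x \<in> integer_lattice \<Longrightarrow> y \<in> integer_lattice \<Longrightarrow> x - y \<in> integer_lattice"
  by (auto simp: integer_lattice_def inner_diff_left)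

lemma integer_lattice_scaleR:
  "x \<in> integer_lattice \<Longrightarrow> c \<in> \<int> \<Longrightarrow> c *\<^sub>R x \<in> integer_lattice"
  by (auto simp: integer_lattice_def)

lemma integer_lattice_inner:
  assumes "x \<in> integer_lattice" "y \<in> integer_lattice"
  shows "x \<bullet> y \<in> \<int>"
  using assms unfolding euclidean_inner[of x y] integer_lattice_def
  by (auto intro!: Ints_sum Ints_mult)

text \<open>By Krein-Milman the extreme points generate a polytope, and the extreme points of a hull
  lie among its generators. Any finite generating set of lattice points may thus replace the
  vertices.\<close>

lemma lattice_polytope_iff:
  "lattice_polytope P \<longleftrightarrow> (\<exists>A. finite A \<and> A \<subseteq> integer_lattice \<and> P = convex hull A)"
proof
  assume P: "lattice_polytope P"
  then obtain A where A: "finite A" "P = convex hull A"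
    unfolding lattice_polytope_def polytope_def by blast
  then have "finite {v. v extreme_point_of P}"
    using extreme_points_of_convex_hull finite_subset by blast
  moreover have "P = convex hull {v. v extreme_point_of P}"
    using A Krein_Milman_polytope by blast
  ultimately show "\<exists>A. finite A \<and> A \<subseteq> integer_lattice \<and> P = convex hull A"
    using P unfolding lattice_polytope_def by blast
next
  assume "\<exists>A. finite A \<and> A \<subseteq> integer_lattice \<and> P = convex hull A"
  then show "lattice_polytope P"
    unfolding lattice_polytope_def polytope_def using extreme_points_of_convex_hull by blast
qed

text \<open>The case \<open>k = 0\<close> is included, as an empty sum, because either of the two
  dilation factors \<open>s\<close> and \<open>k - s\<close> in the final argument may
  vanish.\<close>

lemma integrally_closedE:
  assumes "integrally_closed P" "p \<in> P" "real k *\<^sub>R p \<in> integer_lattice"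
  obtains y where "\<And>j. j \<in> {1..k} \<Longrightarrow> y j \<in> P \<inter> integer_lattice" "real k *\<^sub>R p = (\<Sum>j=1..k. y j)"
proof (cases "k = 0")
  case True
  then show ?thesis using that[of "\<lambda>_. 0"] by simp
next
  case False
  then have "\<exists>y. (\<forall>j\<in>{1..k}. y j \<in> P \<inter> integer_lattice) \<and> real k *\<^sub>R p = (\<Sum>j=1..k. y j)"
    using assms by (auto simp: integrally_closed_def)
  then show ?thesis using that by blast
qed

text \<open>Adding \<open>k\<close> copies of the lattice vector \<open>v\<close> leads back to a
  lattice point of a dilate of \<open>Q\<close>; afterwards each of the \<open>k\<close> summands
  gives back one copy.\<close>

lemma integrally_closed_translationE:
  assumes Q: "integrally_closed Q" and v: "v \<in> integer_lattice"
    and q: "q \<in> Q" "real k *\<^sub>R (q - v) \<in> integer_lattice"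
  obtains y where "\<And>j. j \<in> {1..k} \<Longrightarrow> y j \<in> (\<lambda>q. q - v) ` Q \<inter> integer_lattice"
    "real k *\<^sub>R (q - v) = (\<Sum>j=1..k. y j)"
proof -
  have "real k *\<^sub>R (q - v) + real k *\<^sub>R v \<in> integer_lattice"
    by (rule integer_lattice_add[OF q(2) integer_lattice_scaleR[OF v]]) simp
  then have "real k *\<^sub>R q \<in> integer_lattice"
    by (simp add: algebra_simps)
  from integrally_closedE[OF Q q(1) this] obtain y
    where y: "\<And>j. j \<in> {1..k} \<Longrightarrow> y j \<in> Q \<inter> integer_lattice"
      and s: "real k *\<^sub>R q = (\<Sum>j=1..k. y j)" by blast
  show ?thesis
  proof (rule that[of "\<lambda>j. y j - v"])
    show "y j - v \<in> (\<lambda>q. q - v) ` Q \<inter> integer_lattice" if "j \<in> {1..k}" for j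
      using y[OF that] v by (auto intro: integer_lattice_diff)
    show "real k *\<^sub>R (q - v) = (\<Sum>j=1..k. y j - v)"
      by (simp add: s sum_subtractf scaleR_diff_right sum_constant_scaleR)
  qed
qed

section \<open>The free sum in terms of generators and of segments\<close>

lemma free_sum_at_convex_hull:
  fixes A :: "'a::euclidean_space set" and B :: "'b::euclidean_space set"
  shows "free_sum_at (convex hull A) (convex hull B) v =
    convex hull (A \<times> {0} \<union> {0} \<times> (\<lambda>q. q - v) ` B)" (is "_ = convex hull ?S")
proof -
  have "(convex hull A) \<times> {0 :: 'b} = convex hull (A \<times> {0})"
    by (simp add: convex_hull_Times)
  moreover have "{0 :: 'a} \<times> (\<lambda>q. q - v) ` (convex hull B) = convex hull ({0} \<times> (\<lambda>q. q - v) ` B)"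
    using convex_hull_translation[of "-v" B] by (simp add: convex_hull_Times)
  ultimately have "free_sum_at (convex hull A) (convex hull B) v =
      convex hull (convex hull (A \<times> {0}) \<union> convex hull ({0} \<times> (\<lambda>q. q - v) ` B))"
    by (simp only: free_sum_at_def)
  also have "\<dots> = convex hull ?S"
    by (rule hull_Un[symmetric]) (auto intro: convex_Inter)
  finally show ?thesis .
qed

lemma lattice_polytope_free_sum_at:
  fixes P :: "'a::euclidean_space set" and Q :: "'b::euclidean_space set"
  assumes "lattice_polytope P" "lattice_polytope Q" "v \<in> integer_lattice"
  shows "lattice_polytope (free_sum_at P Q v)"
proof -
  obtain A B where A: "finite A" "A \<subseteq> integer_lattice" "P = convex hull A"
    and B: "finite B" "B \<subseteq> integer_lattice" "Q = convex hull B"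
    using assms lattice_polytope_iff by metis
  have "A \<times> {0 :: 'b} \<union> {0 :: 'a} \<times> (\<lambda>q. q - v) ` B \<subseteq> integer_lattice"
    using A B assms(3)
    by (auto simp: integer_lattice_prod integer_lattice_zero intro!: integer_lattice_diff)
  moreover have "finite (A \<times> {0 :: 'b} \<union> {0 :: 'a} \<times> (\<lambda>q. q - v) ` B)"
    using A(1) B(1) by simp
  ultimately show ?thesis
    unfolding A(3) B(3) free_sum_at_convex_hull by (metis lattice_polytope_iff)
qed

text \<open>The hull of two nonempty convex sets is the union of the segments joining them;
  \<open>u\<close> is the weight on the side of \<open>P\<close>.\<close>

lemma free_sum_atE:
  assumes "z \<in> free_sum_at P Q v" "convex P" "convex Q" "P \<noteq> {}" "Q \<noteq> {}"
  obtains u p q where "0 \<le> u" "u \<le> 1" "p \<in> P" "q \<in> Q" "z = (u *\<^sub>R p, (1 - u) *\<^sub>R (q - v))"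
proof -
  have "convex ((\<lambda>q. q - v) ` Q)"
    using convex_translation[of Q "-v"] assms(3) by simp
  then have "z \<in> {u *\<^sub>R s + w *\<^sub>R t | u w s t. u \<ge> 0 \<and> w \<ge> 0 \<and> u + w = 1 \<and>
      s \<in> P \<times> {0} \<and> t \<in> {0} \<times> (\<lambda>q. q - v) ` Q}"
    using assms convex_hull_union_two[of "P \<times> {0}" "{0} \<times> (\<lambda>q. q - v) ` Q"]
    by (auto simp: free_sum_at_def convex_Times)
  then obtain u w p q where "u \<ge> 0" "w \<ge> 0" "u + w = 1" "p \<in> P" "q \<in> Q"
      "z = u *\<^sub>R (p, 0) + w *\<^sub>R (0, q - v)"
    by blast
  then show ?thesis
    using that[of u p q] by (simp add: eq_diff_eq add.commute)
qed

text \<open>Dilates of a convex set containing 0 are nested, since shrinking towards 0 stays inside.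
  This serves to round a real dilation factor up to an integer.\<close>

lemma scaled_convex_mono:
  assumes "convex S" "0 \<in> S" "x \<in> S" "0 \<le> r" "r \<le> t"
  obtains y where "y \<in> S" "r *\<^sub>R x = t *\<^sub>R y"
proof (cases "t = 0")
  case True
  then show ?thesis using that[of 0] assms by simp
next
  case False
  have "(r / t) *\<^sub>R x + (1 - r / t) *\<^sub>R 0 \<in> S"
    using assms False by (intro convexD) auto
  then show ?thesis using that[of "(r / t) *\<^sub>R x"] False by simp
qed

section \<open>Polar duality and integrality of the gauge\<close>

text \<open>This is the bipolar theorem: a point outside \<open>P\<close> is cut off by a separating
  hyperplane, which yields an element of the polar dual.\<close>

lemma mem_iff_polar_dual:
  assumes "convex P" "closed P" "0 \<in> P"
  shows "x \<in> P \<longleftrightarrow> (\<forall>y\<in>polar_dual P. x \<bullet> y \<le> 1)"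
proof
  assume "x \<in> P"
  then show "\<forall>y\<in>polar_dual P. x \<bullet> y \<le> 1" by (simp add: polar_dual_def)
next
  assume *: "\<forall>y\<in>polar_dual P. x \<bullet> y \<le> 1"
  show "x \<in> P"
  proof (rule ccontr)
    assume "x \<notin> P"
    then obtain a b where ab: "a \<bullet> x < b" "\<forall>z\<in>P. a \<bullet> z > b"
      using separating_hyperplane_closed_point assms by blast
    then have b: "b < 0" using assms(3) by fastforce
    \<comment> \<open>Dividing by the negative \<open>b\<close> reverses both inequalities:
      \<open>P\<close> lands on the side \<open>\<le> 1\<close> and \<open>x\<close> strictly beyond
      it.\<close>
    define y where "y = (1 / b) *\<^sub>R a"
    have "z \<bullet> y \<le> 1" if "z \<in> P" for z
      using ab(2) that b by (fastforce simp: y_def inner_commute[of a] divide_simps)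
    then have "x \<bullet> y \<le> 1" using * by (auto simp: polar_dual_def)
    then show False
      using ab(1) b by (simp add: y_def inner_commute[of a] divide_simps split: if_splits)
  qed
qed

text \<open>Reflexivity turns \<open>P\<close> into a finite system of inequalities with integral
  normals and right-hand side 1. Testing generators of the dual suffices because a halfspace is
  convex.\<close>

lemma reflexive_at_originE:
  assumes "reflexive_at_origin P"
  obtains V where "finite V" "V \<subseteq> integer_lattice"
    "\<And>x. x \<in> P \<longleftrightarrow> (\<forall>y\<in>V. x \<bullet> y \<le> 1)"
proof -
  obtain V where V: "finite V" "V \<subseteq> integer_lattice" "polar_dual P = convex hull V"
    using assms unfolding reflexive_at_origin_def lattice_polytope_iff by blast
  have P: "polytope P" "0 \<in> P"
    using assms interior_subset by (auto simp: reflexive_at_origin_def lattice_polytope_def)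
  have "x \<in> P \<longleftrightarrow> (\<forall>y\<in>V. x \<bullet> y \<le> 1)" for x
  proof -
    have "x \<in> P \<longleftrightarrow> polar_dual P \<subseteq> {y. x \<bullet> y \<le> 1}"
      using mem_iff_polar_dual[of P x] P
      by (auto simp: polytope_imp_convex polytope_imp_closed)
    also have "\<dots> \<longleftrightarrow> V \<subseteq> {y. x \<bullet> y \<le> 1}"
      unfolding V(3) by (rule subset_hull) (rule convex_halfspace_le)
    finally show ?thesis by blast
  qed
  then show ?thesis using that V by blast
qed

lemma bounded_ray_zero:
  assumes "bounded S" "\<And>c. c > 0 \<Longrightarrow> c *\<^sub>R x \<in> S"
  shows "x = (0 :: 'a :: real_normed_vector)"
proof (rule ccontr)
  assume "x \<noteq> 0"
  obtain B where B: "B > 0" "\<And>y. y \<in> S \<Longrightarrow> norm y \<le> B"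
    using assms(1) bounded_pos by blast
  have "norm (((B + 1) / norm x) *\<^sub>R x) \<le> B"
    using assms(2) B \<open>x \<noteq> 0\<close> by (intro B(2)) auto
  then show False using B \<open>x \<noteq> 0\<close> by simp
qed

lemma reflexive_bounded:
  "reflexive_at_origin P \<Longrightarrow> bounded P"
  by (simp add: reflexive_at_origin_def lattice_polytope_def polytope_imp_bounded)

text \<open>All positive multiples of such an \<open>x\<close> satisfy the inequalities, and a
  bounded set contains no ray.\<close>

lemma reflexive_nonpos_zero:
  assumes "reflexive_at_origin P" "\<And>x. x \<in> P \<longleftrightarrow> (\<forall>y\<in>V. x \<bullet> y \<le> 1)"
    and "\<And>y. y \<in> V \<Longrightarrow> x \<bullet> y \<le> 0"
  shows "x = 0"
proof (rule bounded_ray_zero)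
  show "bounded P" using assms(1) by (rule reflexive_bounded)
  show "c *\<^sub>R x \<in> P" if "c > 0" for c
    unfolding assms(2) using assms(3) that
    by (auto intro!: order.trans[OF mult_nonneg_nonpos[of c]])
qed

text \<open>An interior point satisfies every inequality strictly; for a lattice point the products
  are integers below 1, hence at most 0.\<close>

lemma reflexive_interior_lattice_point:
  assumes R: "reflexive_at_origin R" and t: "t \<in> interior R" "t \<in> integer_lattice"
  shows "t = 0"
proof -
  obtain V where V: "finite V" "V \<subseteq> integer_lattice"
      "\<And>x. x \<in> R \<longleftrightarrow> (\<forall>y\<in>V. x \<bullet> y \<le> 1)"
    using reflexive_at_originE[OF R] by blast
  have "t \<bullet> y \<le> 0" if y: "y \<in> V" for y
  proof -
    have "t \<bullet> y < 1"
    \<comment> \<open>The interior of the halfspace is the open halfspace only for a nonzero normal;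
      for \<open>y = 0\<close> the product is 0.\<close>
    proof (cases "y = 0")
      case False
      have "R \<subseteq> {x. y \<bullet> x \<le> 1}" using V(3) y by (auto simp: inner_commute)
      then have "interior R \<subseteq> interior {x. y \<bullet> x \<le> 1}" by (rule interior_mono)
      then have "t \<in> {x. y \<bullet> x < 1}"
        using t(1) interior_halfspace_le[OF False, of 1] by blast
      then show ?thesis by (simp add: inner_commute)
    qed simp
    moreover have "t \<bullet> y \<in> \<int>" using integer_lattice_inner t(2) V(2) y by blast
    ultimately show ?thesis by (auto elim!: Ints_cases)
  qed
  then show "t = 0" using reflexive_nonpos_zero[OF R V(3)] by blast
qed

text \<open>If 0 is interior to the translate of \<open>R\<close> by \<open>t\<close>, then
  \<open>- t\<close> is an interior lattice point of \<open>R\<close>, so the translation is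
  trivial.\<close>

lemma reflexive_polytope_at_origin:
  assumes "reflexive_polytope P" "0 \<in> interior P"
  shows "reflexive_at_origin P"
proof -
  obtain t R where t: "t \<in> integer_lattice" and R: "reflexive_at_origin R"
      and P: "P = (\<lambda>x. x + t) ` R"
    using assms(1) reflexive_polytope_def by blast
  have "interior P = (\<lambda>x. x + t) ` interior R"
    using interior_translation[of t R] by (simp add: P add.commute)
  then have "- t \<in> interior R" using assms(2) by (auto simp: add_eq_0_iff2)
  moreover have "- t \<in> integer_lattice"
    using integer_lattice_diff[OF integer_lattice_zero t] by simp
  ultimately have "t = 0" using reflexive_interior_lattice_point[OF R] by fastforce
  then show ?thesis using R P by simp
qed

text \<open>The gauge of the lattice point \<open>r *\<^sub>R p\<close> is the maximum of 0 and its
  products with the integral normals, all of which are integers, and it is at most \<open>r\<close>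
  because \<open>p \<in> P\<close>.\<close>

lemma reflexive_integer_gauge:
  assumes P: "reflexive_at_origin P" and p: "p \<in> P" "0 \<le> r" "r *\<^sub>R p \<in> integer_lattice"
  obtains s :: nat and p' where "real s \<le> r" "p' \<in> P" "r *\<^sub>R p = real s *\<^sub>R p'"
proof -
  obtain V where V: "finite V" "V \<subseteq> integer_lattice"
      "\<And>x. x \<in> P \<longleftrightarrow> (\<forall>y\<in>V. x \<bullet> y \<le> 1)"
    using reflexive_at_originE[OF P] by blast
  define a where "a = r *\<^sub>R p"
  \<comment> \<open>Inserting 0 makes the maximum well defined and nonnegative whatever
    \<open>V\<close> is.\<close>
  define s where "s = Max (insert 0 ((\<lambda>y. a \<bullet> y) ` V))"
  have s_mem: "s \<in> insert 0 ((\<lambda>y. a \<bullet> y) ` V)"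
    unfolding s_def using V(1) by (intro Max_in) auto
  have s_ge: "0 \<le> s" "\<And>y. y \<in> V \<Longrightarrow> a \<bullet> y \<le> s"
    unfolding s_def using V(1) by (auto intro: Max_ge)
  have "s \<in> \<int>"
    using s_mem integer_lattice_inner[OF p(3)] V(2) by (auto simp: a_def)
  then obtain n where n: "s = real n"
    using s_ge(1) by (metis Ints_cases of_int_0_le_iff of_int_of_nat_eq zero_le_imp_eq_int)
  have "a \<bullet> y \<le> r" if "y \<in> V" for y
    using V(3)[of p] p that mult_left_mono[of "p \<bullet> y" 1 r] by (simp add: a_def)
  then have "s \<le> r" using s_mem p(2) by auto
  have "0 \<in> P" using P interior_subset by (auto simp: reflexive_at_origin_def)
  show ?thesis
  \<comment> \<open>Gauge 0 forces \<open>a = 0\<close>; otherwise dividing by the gauge gives a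
    point of \<open>P\<close>.\<close>
  proof (cases "n = 0")
    case True
    then have "a = 0" using reflexive_nonpos_zero[OF P V(3), of a] s_ge n by simp
    then show ?thesis using that[of 0 0] \<open>0 \<in> P\<close> p(2) by (simp add: a_def)
  next
    case False
    then have "(1 / s) *\<^sub>R a \<in> P"
      using V(3) s_ge n by (auto simp: divide_simps)
    moreover have "r *\<^sub>R p = real n *\<^sub>R (1 / s) *\<^sub>R a"
      using n False by (simp flip: a_def)
    ultimately show ?thesis
      using that \<open>s \<le> r\<close> n by blast
  qed
qed

section \<open>Integral closedness of the free sum\<close>

theorem integrally_closed_free_sum_at:
  assumes P: "reflexive_at_origin P" "integrally_closed P"
    and Q: "integrally_closed Q" and v: "v \<in> Q" "v \<in> integer_lattice"
  shows "integrally_closed (free_sum_at P Q v)"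
  unfolding integrally_closed_def
proof (intro conjI allI impI ballI)
  have poly: "lattice_polytope P" "lattice_polytope Q"
    using P Q by (auto simp: integrally_closed_def)
  then show "lattice_polytope (free_sum_at P Q v)"
    using v by (intro lattice_polytope_free_sum_at)
  have conv: "convex P" "convex Q"
    using poly by (auto simp: lattice_polytope_def polytope_imp_convex)
  have "0 \<in> P" using P interior_subset by (auto simp: reflexive_at_origin_def)
  have inl: "(p, 0) \<in> free_sum_at P Q v" if "p \<in> P" for p
    unfolding free_sum_at_def using that by (intro hull_inc) auto
  have inr: "(0, q) \<in> free_sum_at P Q v" if "q \<in> (\<lambda>q. q - v) ` Q" for q
    unfolding free_sum_at_def using that by (intro hull_inc) auto
  fix k :: nat and x
  assume "x \<in> (\<lambda>p. real k *\<^sub>R p) ` free_sum_at P Q v \<inter> integer_lattice"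
  then obtain z where z: "z \<in> free_sum_at P Q v" "x = real k *\<^sub>R z" "x \<in> integer_lattice"
    by blast
  obtain u p q where u: "0 \<le> u" "u \<le> 1" and p: "p \<in> P" and q: "q \<in> Q"
      and z_eq: "z = (u *\<^sub>R p, (1 - u) *\<^sub>R (q - v))"
    using free_sum_atE[OF z(1) conv] \<open>0 \<in> P\<close> v(1) by blast
  have x_eq: "x = ((real k * u) *\<^sub>R p, (real k * (1 - u)) *\<^sub>R (q - v))"
    by (simp add: z(2) z_eq)
  then have lat: "(real k * u) *\<^sub>R p \<in> integer_lattice"
      "(real k * (1 - u)) *\<^sub>R (q - v) \<in> integer_lattice"
    using z(3) by (auto simp: integer_lattice_prod)
  obtain s p' where s: "real s \<le> real k * u" and p': "p' \<in> P"
      and sp': "(real k * u) *\<^sub>R p = real s *\<^sub>R p'"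
    using reflexive_integer_gauge[OF P(1) p _ lat(1)] u by auto
  have "real k * u \<le> real k"
    using u by (simp add: mult_left_le)
  then have "s \<le> k" using s by linarith
  have "convex ((\<lambda>q. q - v) ` Q)"
    using convex_translation[of Q "-v"] conv(2) by simp
  moreover have "0 \<in> (\<lambda>q. q - v) ` Q" using v(1) by force
  \<comment> \<open>Replacing the weight \<open>real k * u\<close> by the gauge \<open>s\<close>
    leaves slack, which the translate of \<open>Q\<close> absorbs because it contains 0. Both
    factors are now integers with sum \<open>k\<close>.\<close>
  moreover have "real k * (1 - u) \<le> real (k - s)"
    using s \<open>s \<le> k\<close> by (simp add: of_nat_diff algebra_simps)
  ultimately obtain q' where q': "q' \<in> Q"
      and rq': "(real k * (1 - u)) *\<^sub>R (q - v) = real (k - s) *\<^sub>R (q' - v)"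
    using scaled_convex_mono[of "(\<lambda>q. q - v) ` Q" "q - v" "real k * (1 - u)" "real (k - s)"]
      u q by auto
  obtain f where f: "\<And>j. j \<in> {1..s} \<Longrightarrow> f j \<in> P \<inter> integer_lattice"
      "real s *\<^sub>R p' = (\<Sum>j=1..s. f j)"
    using integrally_closedE[OF P(2) p', of s] lat(1) sp' by metis
  obtain g where g: "\<And>j. j \<in> {1..k - s} \<Longrightarrow> g j \<in> (\<lambda>q. q - v) ` Q \<inter> integer_lattice"
      "real (k - s) *\<^sub>R (q' - v) = (\<Sum>j=1..k - s. g j)"
    using integrally_closed_translationE[OF Q v(2) q', of "k - s"] lat(2) rq' by metis
  \<comment> \<open>The first \<open>s\<close> summands come from \<open>P\<close>, the other
    \<open>k - s\<close> from the translate of \<open>Q\<close>, with indices shifted by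
    \<open>s\<close>.\<close>
  define y where "y j = (if j \<le> s then (f j, 0) else (0, g (j - s)))" for j
  have "y j \<in> free_sum_at P Q v \<inter> integer_lattice" if "j \<in> {1..k}" for j
  proof (cases "j \<le> s")
    case True
    then show ?thesis
      using f(1)[of j] that inl by (simp add: y_def integer_lattice_prod integer_lattice_zero)
  next
    case False
    then have "j - s \<in> {1..k - s}" using that by auto
    from g(1)[OF this] show ?thesis
      using False inr by (simp add: y_def integer_lattice_prod integer_lattice_zero)
  qed
  moreover have "x = (\<Sum>j=1..k. y j)"
  proof -
    have "(\<Sum>j=1..k. y j) = (\<Sum>j=1..s. y j) + (\<Sum>j=s+1..k. y j)"
      using sum.ub_add_nat[of 1 s y "k - s"] \<open>s \<le> k\<close> by simp
    also have "(\<Sum>j=1..s. y j) = (\<Sum>j=1..s. (f j, 0))"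
      by (rule sum.cong) (auto simp: y_def)
    also have "(\<Sum>j=s+1..k. y j) = (\<Sum>j=1..k - s. y (j + s))"
      using sum.shift_bounds_cl_nat_ivl[of y 1 s "k - s"] \<open>s \<le> k\<close> by simp
    also have "\<dots> = (\<Sum>j=1..k - s. (0, g j))"
      by (rule sum.cong) (auto simp: y_def)
    finally show ?thesis
      by (simp add: x_eq sp' rq' f(2) g(2) sum_prod)
  qed
  ultimately show "\<exists>y. (\<forall>j\<in>{1..k}. y j \<in> free_sum_at P Q v \<inter> integer_lattice) \<and>
      x = (\<Sum>j=1..k. y j)"
    by blast
qed

section \<open>The free sum is a simplex\<close>

text \<open>The affine hull contains both coordinate subspaces, in particular 0. It is therefore a
  linear subspace, closed under the sums \<open>(x, 0) + (0, y)\<close>.\<close>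

lemma affine_hull_Un_axes:
  fixes A :: "'a::euclidean_space set" and B :: "'b::euclidean_space set"
  assumes "affine hull A = UNIV" "affine hull B = UNIV"
  shows "affine hull (A \<times> {0} \<union> {0} \<times> B) = UNIV" (is "?H = _")
proof -
  have lin: "bounded_linear (\<lambda>x::'a. (x, 0::'b))" "bounded_linear (\<lambda>y::'b. (0::'a, y))"
    by (intro bounded_linear_Pair bounded_linear_ident bounded_linear_zero)+
  have l: "(x, 0) \<in> ?H" for x
  proof -
    have "(\<lambda>x. (x, 0 :: 'b)) ` (affine hull A) = affine hull ((\<lambda>x. (x, 0)) ` A)"
      by (rule affine_hull_linear_image[OF lin(1)])
    also have "\<dots> \<subseteq> ?H" by (rule hull_mono) auto
    finally show ?thesis using assms(1) by auto
  qed
  have r: "(0, y) \<in> ?H" for y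
  proof -
    have "(\<lambda>y. (0 :: 'a, y)) ` (affine hull B) = affine hull ((\<lambda>y. (0, y)) ` B)"
      by (rule affine_hull_linear_image[OF lin(2)])
    also have "\<dots> \<subseteq> ?H" by (rule hull_mono) auto
    finally show ?thesis using assms(2) by auto
  qed
  have "subspace ?H"
    unfolding subspace_affine using l[of 0] by (simp add: zero_prod_def)
  then have "(x, y) \<in> ?H" for x y
    using subspace_add[OF _ l[of x] r[of y]] by simp
  then show ?thesis by auto
qed

text \<open>The generators without the shared origin still affinely span the whole space, and there
  are just few enough of them to be affinely independent.\<close>

lemma simplex_free_sum_at:
  fixes P :: "'a::euclidean_space set" and Q :: "'b::euclidean_space set"
  assumes P: "int DIM('a) simplex P" "0 \<in> interior P"
    and Q: "int DIM('b) simplex Q" "v extreme_point_of Q"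
  shows "int (DIM('a) + DIM('b)) simplex free_sum_at P Q v"
proof -
  obtain C where C: "\<not> affine_dependent C" "int (card C) = DIM('a) + 1" "P = convex hull C"
    using P(1) unfolding simplex_def by auto
  obtain D where D: "\<not> affine_dependent D" "int (card D) = DIM('b) + 1" "Q = convex hull D"
    using Q(1) unfolding simplex_def by auto
  have fin: "finite C" "finite D" using C D aff_independent_finite by auto
  have "v \<in> D" using Q(2) D extreme_point_of_convex_hull by blast
  define E where "E = (\<lambda>q. q - v) ` D"
  have E0: "0 \<in> E" using \<open>v \<in> D\<close> by (force simp: E_def)
  have "card E = card D" unfolding E_def by (rule card_image) (auto simp: inj_on_def)
  \<comment> \<open>The vertex \<open>v\<close> of \<open>Q\<close> becomes the origin, which is interior to \<open>P\<close> and hence not a vertex.\<close>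
  define S where "S = C \<times> {0} \<union> {0} \<times> (E - {0})"
  have "convex hull S = convex hull (insert 0 S)"
  proof (rule hull_redundant[symmetric])
    have "0 \<in> (convex hull C) \<times> {0}"
      using P(2) interior_subset by (auto simp: C(3) zero_prod_def)
    also have "\<dots> = convex hull (C \<times> {0})" by (simp add: convex_hull_Times)
    also have "\<dots> \<subseteq> convex hull S" by (rule hull_mono) (simp add: S_def)
    finally show "0 \<in> convex hull S" .
  qed
  also have "insert 0 S = C \<times> {0} \<union> {0} \<times> E"
    using E0 by (auto simp: S_def zero_prod_def)
  finally have hull: "free_sum_at P Q v = convex hull S"
    and "convex hull S = convex hull (C \<times> {0} \<union> {0} \<times> E)"
    by (simp_all add: C(3) D(3) free_sum_at_convex_hull E_def)
  then have "affine hull S = affine hull (C \<times> {0} \<union> {0} \<times> E)"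
    by (metis affine_hull_convex_hull)
  also have "\<dots> = UNIV"
  proof (rule affine_hull_Un_axes)
    show "affine hull C = UNIV"
      using C aff_dim_affine_independent aff_dim_eq_full[of C] by fastforce
    have "affine hull D = UNIV"
      using D aff_dim_affine_independent aff_dim_eq_full[of D] by fastforce
    then show "affine hull E = UNIV"
      using affine_hull_translation[of "-v" D] by (simp add: E_def)
  qed
  finally have dim: "aff_dim S = DIM('a) + DIM('b)"
    using aff_dim_eq_full[of S] by simp
  have "finite S" using fin by (simp add: S_def E_def)
  have "card S \<le> card (C \<times> {0::'b}) + card ({0::'a} \<times> (E - {0}))"
    unfolding S_def by (rule card_Un_le)
  also have "\<dots> = card C + (card D - 1)"
    using E0 fin \<open>card E = card D\<close> by (simp add: card_cartesian_product E_def)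
  finally have "int (card S) \<le> DIM('a) + DIM('b) + 1" using C(2) D(2) by linarith
  \<comment> \<open>An affinely spanning set has at least one more point than the dimension, so the
    upper bound is attained; equality gives affine independence.\<close>
  then have card: "int (card S) = DIM('a) + DIM('b) + 1"
    using aff_dim_le_card[OF \<open>finite S\<close>] dim by simp
  then have "\<not> affine_dependent S"
    using dim \<open>finite S\<close> by (simp add: affine_independent_iff_card)
  then show ?thesis
    unfolding hull using card by (intro simplex_convex_hull) simp
qed

theorem theorem2p6:
  fixes P :: "(real ^ 'n) set" and Q :: "(real ^ 'm) set"
    and v :: "nat \<Rightarrow> real ^ 'm" and i :: nat
  assumes "int CARD('n) simplex P" and "integrally_closed P"
    and "int CARD('m) simplex Q" and "integrally_closed Q"
    and "0 \<in> interior P" and "reflexive_polytope P"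
    and "bij_betw v {0..CARD('m)} {x. x extreme_point_of Q}"
    and "i \<in> {0..CARD('m)}"
  shows "int (CARD('n) + CARD('m)) simplex free_sum_at P Q (v i) \<and>
         integrally_closed (free_sum_at P Q (v i))"
proof
  have v: "v i extreme_point_of Q"
    using assms(7,8) bij_betwE by blast
  then show "int (CARD('n) + CARD('m)) simplex free_sum_at P Q (v i)"
    using simplex_free_sum_at[of P Q "v i"] assms by simp
  \<comment> \<open>A vertex of a lattice polytope is a lattice point, so translation by
    \<open>v i\<close> respects the lattice.\<close>
  have "v i \<in> Q" "v i \<in> integer_lattice"
    using v assms(4) by (auto simp: extreme_point_of_def integrally_closed_def lattice_polytope_def)
  then show "integrally_closed (free_sum_at P Q (v i))"
    using assms reflexive_polytope_at_origin by (intro integrally_closed_free_sum_at) auto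
qed

end
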